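(* There exist $n$-node directed graphs $G$ with $|E(G)|=m$ edges such that for every shortcut set $H$ of $G$ of size $|H|=O(m)$, the diameter of $G\cup H$ is $\Omega(n^{2/9})$. (Here, for every constant $C>0$ the graphs can be chosen so that this holds for all shortcut sets of size at most $Cm$, with the constant in $\Omega$ depending only on $C$.)
   Context: A shortcut set of a directed graph $G$ is a set $H$ of edges $(u,v)$ such that $v$ is reachable from $u$ in $G$. The diameter of $G\cup H$ is the maximum, over all pairs $(s,t)$ with $t$ reachable from $s$ in $G$, of the minimum number of edges on an $s\leadsto t$ path in $G\cup H$. *)

theory Defs
  imports Complex_Main "Graph_Theory.Pair_Digraph"
begin

definition shortcut_set :: "'a pair_pre_digraph \<Rightarrow> ('a \<times> 'a) set \<Rightarrow> bool" where
  "shortcut_set G H \<longleftrightarrow> (\<forall>(u, v) \<in> H. u \<rightarrow>\<^sup>*\<^bsub>with_proj G\<^esub> v)"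

definition add_edges :: "'a pair_pre_digraph \<Rightarrow> ('a \<times> 'a) set \<Rightarrow> 'a pair_pre_digraph" where
  "add_edges G H = G\<lparr>parcs := parcs G \<union> H\<rparr>"

(* The value is arbitrary if t is not reachable from s. Walks instead of simple paths make
   no difference to the minimum. *)
definition hop_dist :: "'a pair_pre_digraph \<Rightarrow> 'a \<Rightarrow> 'a \<Rightarrow> nat" where
  "hop_dist G s t = (LEAST k. \<exists>p. pre_digraph.awalk (with_proj G) s p t \<and> length p = k)"

(* Only pairs that are reachable in G count, so hop_dist is evaluated only where it is
   meaningful; for finite G with at least one vertex the set under Max is finite and nonempty. *)
definition shortcut_diameter :: "'a pair_pre_digraph \<Rightarrow> ('a \<times> 'a) set \<Rightarrow> nat" where
  "shortcut_diameter G H =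
     Max {hop_dist (add_edges G H) s t | s t. s \<rightarrow>\<^sup>*\<^bsub>with_proj G\<^esub> t}"

end

theory Submission
  imports Defs
begin

text \<open>Let \<open>L = 2 ^ p\<close>. The graph has about \<open>T = \<epsilon> L\<^sup>2\<close> layers, each a copy of a box in \<open>\<nat>\<^sup>3\<close> with
  sides of order \<open>T\<close>, \<open>T\<close> and \<open>T L\<close>, hence about \<open>T\<^sup>4 L\<close> nodes, which is \<open>T\<close> to the power
  \<open>9 / 2\<close> up to constants, and out-degree at most two. From each layer one may stay or take the
  step \<open>(1, 0, \<sigma>)\<close> or \<open>(0, 1, \<sigma>)\<close>, alternately, with the threshold \<open>\<sigma> < L\<close> depending on the layer.
  A direction \<open>(c, d)\<close> defines a critical path from every start: take the step iff \<open>\<sigma> < c\<close>,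
  respectively \<open>\<sigma> < d\<close>. A linear functional makes it the only path between its ends.
  Because the thresholds run through \<open>{..<L}\<close> in bit-reversed order, any \<open>t \<le> L\<close> consecutive layers
  separate directions that differ by more than \<open>O(L / t)\<close> in some coordinate, so two nodes at
  distance \<open>t\<close> share only \<open>O(L\<^sup>2 / t\<^sup>2)\<close> critical paths. A shortcut across \<open>t\<close> layers thus
  saves only \<open>O(L\<^sup>2 / t + T)\<close> hops summed over all critical paths. Shortcuts across boundedly many
  layers can only shorten a path by a constant factor, and the others are too few.\<close>

section \<open>Shortcut walks and congestion\<close>

text \<open>A walk in \<open>G\<close> is also one in \<open>add_edges G H\<close>, so the
  \<open>LEAST\<close> is attained for reachable pairs; these are finitely many, so
  \<open>Max\<close> bounds it.\<close>

lemma hop_dist_walk: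
  assumes "pair_fin_digraph G" "shortcut_diameter G H \<le> k" "s \<rightarrow>\<^sup>*\<^bsub>with_proj G\<^esub> t"
  obtains p where "set p \<subseteq> parcs G \<union> H" "pcas s p t" "length p \<le> k"
proof -
  interpret pair_fin_digraph G by fact
  let ?D = "{hop_dist (add_edges G H) s t | s t. s \<rightarrow>\<^sup>*\<^bsub>with_proj G\<^esub> t}"
  let ?P = "\<lambda>k. \<exists>p. pre_digraph.awalk (with_proj (add_edges G H)) s p t \<and> length p = k"
  have "?D \<subseteq> (\<lambda>(s, t). hop_dist (add_edges G H) s t) ` (pverts G \<times> pverts G)"
    by (force dest: reachable_in_verts)
  then have "finite ?D"
    using pair_finite_verts by (meson finite_SigmaI finite_imageI finite_subset)
  moreover have "hop_dist (add_edges G H) s t \<in> ?D"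
    using assms(3) by blast
  ultimately have "hop_dist (add_edges G H) s t \<le> shortcut_diameter G H"
    unfolding shortcut_diameter_def by (rule Max_ge)
  with assms(2) have le: "hop_dist (add_edges G H) s t \<le> k"
    by simp
  obtain q where "awalk s q t"
    using assms(3) reachable_awalk by auto
  then have "pre_digraph.awalk (with_proj (add_edges G H)) s q t"
    by (auto simp: pre_digraph.awalk_def cas_with_proj_eq add_edges_def)
  then have "?P (length q)"
    by blast
  then have "?P (LEAST k. ?P k)"
    by (rule LeastI)
  then obtain p where "pre_digraph.awalk (with_proj (add_edges G H)) s p t"
    "length p = hop_dist (add_edges G H) s t"
    unfolding hop_dist_def by blast
  with le that show thesis
    by (auto simp: pre_digraph.awalk_def cas_with_proj_eq add_edges_def)
qed

text \<open>Every shortcut stands for a path in \<open>G\<close>, so the uniqueness of critical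
  paths in \<open>G\<close> also constrains walks that use \<open>H\<close>.\<close>

lemma shortcut_walk_reachable:
  assumes "pair_wf_digraph G" "shortcut_set G H"
  shows "set p \<subseteq> parcs G \<union> H \<Longrightarrow> pcas s p t \<Longrightarrow> s \<in> pverts G \<Longrightarrow> s \<rightarrow>\<^sup>*\<^bsub>with_proj G\<^esub> t"
    and "set p \<subseteq> parcs G \<union> H \<Longrightarrow> pcas s p t \<Longrightarrow> s \<in> pverts G \<Longrightarrow> (u, v) \<in> set p \<Longrightarrow>
      s \<rightarrow>\<^sup>*\<^bsub>with_proj G\<^esub> u \<and> v \<rightarrow>\<^sup>*\<^bsub>with_proj G\<^esub> t"
proof -
  interpret pair_wf_digraph G by fact
  have arc: "a \<rightarrow>\<^sup>*\<^bsub>with_proj G\<^esub> b" if "(a, b) \<in> parcs G \<union> H" for a b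
    using that assms(2) by (auto simp: shortcut_set_def)
  show reach: "s \<rightarrow>\<^sup>*\<^bsub>with_proj G\<^esub> t" if "set p \<subseteq> parcs G \<union> H" "pcas s p t" "s \<in> pverts G" for p s
    using that
  proof (induction p arbitrary: s)
    case (Cons e p)
    obtain b where e: "e = (s, b)"
      using Cons.prems(2) by (cases e) auto
    then have "s \<rightarrow>\<^sup>*\<^bsub>with_proj G\<^esub> b"
      using Cons.prems(1) arc by auto
    with Cons e show ?case
      by (auto intro: reachable_trans dest: reachable_in_verts)
  qed auto
  show "s \<rightarrow>\<^sup>*\<^bsub>with_proj G\<^esub> u \<and> v \<rightarrow>\<^sup>*\<^bsub>with_proj G\<^esub> t"
    if "set p \<subseteq> parcs G \<union> H" "pcas s p t" "s \<in> pverts G" "(u, v) \<in> set p"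
    using that
  proof (induction p arbitrary: s)
    case (Cons e p)
    obtain b where e: "e = (s, b)"
      using Cons.prems(2) by (cases e) auto
    then have sb: "s \<rightarrow>\<^sup>*\<^bsub>with_proj G\<^esub> b" and b: "b \<in> pverts G"
      using Cons.prems(1) arc by (auto dest: reachable_in_verts)
    show ?case
    proof (cases "(u, v) = e")
      case True
      with Cons.prems e b show ?thesis
        by (auto intro: reach)
    next
      case False
      with Cons e sb b show ?thesis
        by (auto intro: reachable_trans)
    qed
  qed auto
qed

text \<open>The intervals \<open>{f u..<f v}\<close> of the arcs cover \<open>{f s..<f t}\<close>.
  Hence repeated arcs need counting only once, and truncated subtraction lets backward arcs count
  nothing.\<close>

lemma pcas_potential_le:
  fixes f :: "'a \<Rightarrow> nat"
  assumes "pcas s p t"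
  shows "f t - f s \<le> (\<Sum>(u, v)\<in>set p. f v - f u)"
proof -
  have "{f s..<f t} \<subseteq> (\<Union>e\<in>set p. {f (fst e)..<f (snd e)})"
    using assms
  proof (induction p arbitrary: s)
    case (Cons e p)
    then have "{f (snd e)..<f t} \<subseteq> (\<Union>e\<in>set p. {f (fst e)..<f (snd e)})" "fst e = s"
      by auto
    moreover have "{f s..<f t} \<subseteq> {f s..<f (snd e)} \<union> {f (snd e)..<f t}"
      by auto
    ultimately show ?case
      by auto
  qed auto
  then have "card {f s..<f t} \<le> card (\<Union>e\<in>set p. {f (fst e)..<f (snd e)})"
    by (intro card_mono) auto
  also have "\<dots> \<le> (\<Sum>e\<in>set p. card {f (fst e)..<f (snd e)})"
    by (intro card_UN_le) auto
  finally show ?thesis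
    by (simp add: case_prod_beta)
qed

text \<open>A shortcut shorter than \<open>l\<close> advances a walk of at most \<open>k\<close> hops by less than \<open>k * l\<close>
  in total, so the long shortcuts have to cover the remaining layers of every demand, while each
  of them serves few demands.\<close>

lemma congestion_bound:
  fixes f :: "'a \<Rightarrow> nat"
  assumes G: "pair_fin_digraph G" and H: "shortcut_set G H" and diam: "shortcut_diameter G H \<le> k"
    and I: "finite I"
    and demand: "\<And>i. i \<in> I \<Longrightarrow> src i \<rightarrow>\<^sup>*\<^bsub>with_proj G\<^esub> dst i"
    and dist: "\<And>i. i \<in> I \<Longrightarrow> T \<le> f (dst i) - f (src i)"
    and short: "\<And>u v. (u, v) \<in> parcs G \<Longrightarrow> f v - f u < l"
    and cong: "\<And>u v. l \<le> f v - f u \<Longrightarrow>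
      (f v - f u) * card {i \<in> I. src i \<rightarrow>\<^sup>*\<^bsub>with_proj G\<^esub> u \<and> u \<rightarrow>\<^sup>*\<^bsub>with_proj G\<^esub> v \<and>
                              v \<rightarrow>\<^sup>*\<^bsub>with_proj G\<^esub> dst i} \<le> M"
  shows "card I * (T - k * l) \<le> card H * M"
proof -
  interpret pair_fin_digraph G by fact
  let ?on = "\<lambda>i e. src i \<rightarrow>\<^sup>*\<^bsub>with_proj G\<^esub> fst e \<and> fst e \<rightarrow>\<^sup>*\<^bsub>with_proj G\<^esub> snd e \<and> snd e \<rightarrow>\<^sup>*\<^bsub>with_proj G\<^esub> dst i"
  let ?w = "\<lambda>e. f (snd e) - f (fst e)"
  let ?HL = "{e \<in> H. l \<le> ?w e}"
  have "H \<subseteq> pverts G \<times> pverts G"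
    using H by (auto simp: shortcut_set_def dest: reachable_in_verts)
  then have finH: "finite H"
    using pair_finite_verts by (meson finite_SigmaI finite_subset)
  have one: "T - k * l \<le> (\<Sum>e\<in>?HL. if ?on i e then ?w e else 0)" if i: "i \<in> I" for i
  proof -
    obtain p where p: "set p \<subseteq> parcs G \<union> H" "pcas (src i) p (dst i)" "length p \<le> k"
      using hop_dist_walk[OF G diam demand[OF i]] by blast
    have src: "src i \<in> pverts G"
      using demand[OF i] by (auto dest: reachable_in_verts)
    have on: "?on i e" if "e \<in> set p" for e
    proof -
      have "fst e \<rightarrow>\<^sup>*\<^bsub>with_proj G\<^esub> snd e"
        using p(1) that H by (cases e) (auto simp: shortcut_set_def)
      then show ?thesis
        using shortcut_walk_reachable(2)[OF pair_wf_digraph_axioms H p(1,2) src] that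
        by (cases e) auto
    qed
    have "T \<le> (\<Sum>e\<in>set p. ?w e)"
      using dist[OF i] pcas_potential_le[OF p(2), of f] by (simp add: case_prod_beta)
    also have "\<dots> \<le> (\<Sum>e\<in>set p. l + (if l \<le> ?w e then ?w e else 0))"
      by (intro sum_mono) auto
    also have "\<dots> = card (set p) * l + (\<Sum>e\<in>{e \<in> set p. l \<le> ?w e}. ?w e)"
      by (simp add: sum.distrib sum.inter_filter)
    also have "card (set p) * l \<le> k * l"
      using card_length[of p] p(3) by (intro mult_right_mono) auto
    also have "(\<Sum>e\<in>{e \<in> set p. l \<le> ?w e}. ?w e) \<le> (\<Sum>e\<in>{e \<in> ?HL. ?on i e}. ?w e)"
    proof (intro sum_mono2)
      show "{e \<in> set p. l \<le> ?w e} \<subseteq> {e \<in> ?HL. ?on i e}"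
      proof
        fix e assume e: "e \<in> {e \<in> set p. l \<le> ?w e}"
        then have "e \<notin> parcs G"
          using short[of "fst e" "snd e"] by auto
        with e p(1) on[of e] show "e \<in> {e \<in> ?HL. ?on i e}"
          by blast
      qed
    qed (use finH in auto)
    also have "\<dots> = (\<Sum>e\<in>?HL. if ?on i e then ?w e else 0)"
      using finH by (intro sum.inter_filter) auto
    finally show ?thesis
      by simp
  qed
  have "card I * (T - k * l) \<le> (\<Sum>i\<in>I. \<Sum>e\<in>?HL. if ?on i e then ?w e else 0)"
    using sum_mono[OF one, of I] by simp
  \<comment> \<open>Double counting: from the shortcuts used by each demand to the demands served by
    each shortcut.\<close>
  also have "\<dots> = (\<Sum>e\<in>?HL. \<Sum>i\<in>I. if ?on i e then ?w e else 0)"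
    by (rule sum.swap)
  also have "\<dots> = (\<Sum>e\<in>?HL. ?w e * card {i \<in> I. ?on i e})"
    using I by (simp add: sum.inter_filter[symmetric] mult.commute)
  also have "\<dots> \<le> (\<Sum>e\<in>?HL. M)"
    using cong by (intro sum_mono) auto
  also have "\<dots> \<le> card H * M"
    using finH by (auto intro!: mult_right_mono card_mono)
  finally show ?thesis .
qed

section \<open>Bit reversal\<close>

primrec bit_rev :: "nat \<Rightarrow> nat \<Rightarrow> nat" where
  "bit_rev 0 i = 0"
| "bit_rev (Suc p) i = 2 * bit_rev p i + i div 2 ^ p mod 2"

lemma bit_rev_less: "bit_rev p i < 2 ^ p"
proof (induction p)
  case (Suc p)
  have "i div 2 ^ p mod 2 < 2"
    by simp
  with Suc show ?case
    unfolding bit_rev.simps power_Suc by linarith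
qed simp

text \<open>The leading bits of the reversal come from the trailing bits of \<open>i\<close>, so the
  residue modulo \<open>2 ^ j\<close> selects a dyadic block of length
  \<open>2 ^ (p - j)\<close>.\<close>

lemma bit_rev_div: "j \<le> p \<Longrightarrow> bit_rev p i div 2 ^ (p - j) = bit_rev j i"
proof (induction p)
  case (Suc p)
  show ?case
  proof (cases "j = Suc p")
    case False
    with Suc.prems have "j \<le> p"
      by simp
    then have "bit_rev (Suc p) i div 2 ^ (Suc p - j) = bit_rev (Suc p) i div 2 div 2 ^ (p - j)"
      by (simp add: Suc_diff_le div_mult2_eq)
    also have "bit_rev (Suc p) i div 2 = bit_rev p i"
      by simp
    finally show ?thesis
      using Suc.IH \<open>j \<le> p\<close> by simp
  qed simp
qed simp

lemma bit_rev_cong: "i mod 2 ^ p = i' mod 2 ^ p \<Longrightarrow> bit_rev p i = bit_rev p i'"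
proof (induction p)
  case (Suc p)
  have split: "a mod 2 ^ Suc p = 2 ^ p * (a div 2 ^ p mod 2) + a mod 2 ^ p" for a :: nat
    using mod_mult2_eq[of a "2 ^ p" 2] by (simp add: mult.commute)
  have *: "a mod 2 ^ p = (a mod 2 ^ Suc p) mod 2 ^ p"
    "a div 2 ^ p mod 2 = (a mod 2 ^ Suc p) div 2 ^ p" for a :: nat
    unfolding split by simp_all
  show ?case
    using Suc *[of i] *[of i'] by simp
qed simp

lemma bit_rev_surj: "b < 2 ^ p \<Longrightarrow> \<exists>e<2 ^ p. bit_rev p e = b"
proof (induction p arbitrary: b)
  case (Suc p)
  then obtain e where e: "e < 2 ^ p" "bit_rev p e = b div 2"
    by (metis less_mult_imp_div_less mult.commute power_Suc)
  define e' where "e' = e + 2 ^ p * (b mod 2)"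
  have "bit_rev p e' = bit_rev p e"
    by (rule bit_rev_cong) (simp add: e'_def)
  moreover have "e' div 2 ^ p mod 2 = b mod 2"
    using e by (simp add: e'_def)
  ultimately have "bit_rev (Suc p) e' = b"
    using e(2) by simp
  moreover have "e' < 2 ^ Suc p"
    using e(1) by (cases "even b") (auto simp: e'_def even_iff_mod_2_eq_zero odd_iff_mod_2_eq_one)
  ultimately show ?case
    by blast
qed simp

lemma ex_mod_in_window:
  fixes r M l :: nat
  assumes "r < M"
  shows "\<exists>q. l \<le> r + M * q \<and> r + M * q < l + M"
proof -
  have l: "l = M * (l div M) + l mod M" "l mod M < M"
    using assms by auto
  show ?thesis
  proof (cases "l mod M \<le> r")
    case True
    then show ?thesis
      using l assms by (intro exI[of _ "l div M"]) linarith
  next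
    case False
    then show ?thesis
      using l assms by (intro exI[of _ "Suc (l div M)"]) (simp only: mult_Suc_right, linarith)
  qed
qed

text \<open>Fixing the parity of \<open>i\<close> and the \<open>j\<close> lowest bits of
  \<open>i div 2\<close> fixes \<open>i\<close> modulo \<open>2 ^ Suc j\<close>, and a window of
  that length meets every residue class.\<close>

lemma bit_rev_window:
  assumes "j \<le> p" "b < 2 ^ j"
  shows "\<exists>i. l \<le> i \<and> i < l + 2 ^ Suc j \<and> even i = par \<and> bit_rev p (i div 2) div 2 ^ (p - j) = b"
proof -
  obtain e where e: "e < 2 ^ j" "bit_rev j e = b"
    using bit_rev_surj[OF assms(2)] by blast
  define r where "r = 2 * e + of_bool (\<not> par)"
  have "r < 2 ^ Suc j"
    using e(1) by (auto simp: r_def)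
  then obtain q where q: "l \<le> r + 2 ^ Suc j * q" "r + 2 ^ Suc j * q < l + 2 ^ Suc j"
    using ex_mod_in_window by blast
  let ?i = "r + 2 ^ Suc j * q"
  have "?i div 2 = e + 2 ^ j * q"
    by (simp add: r_def)
  then have "bit_rev j (?i div 2) = b"
    using e bit_rev_cong[of "?i div 2" j e] by simp
  moreover have "even ?i = par"
    by (auto simp: r_def)
  ultimately show ?thesis
    using q bit_rev_div[OF assms(1)] by metis
qed

section \<open>The layered graph\<close>

text \<open>Layer \<open>i\<close> offers either the zero step or the step
  \<open>(1, 0, thr p i)\<close> (\<open>i\<close> even) or \<open>(0, 1, thr p i)\<close> (\<open>i\<close> odd) in the coordinates \<open>(x, z, y)\<close>.\<close>

type_synonym node = "nat \<times> nat \<times> nat \<times> nat"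

text \<open>Halving the index lets even and odd layers each run through the whole bit-reversed
  sequence.\<close>

definition thr :: "nat \<Rightarrow> nat \<Rightarrow> nat" where
  "thr p i = bit_rev p (i div 2)"

fun move :: "nat \<Rightarrow> bool \<Rightarrow> node \<Rightarrow> node" where
  "move p b (i, x, z, y) =
    (Suc i, x + of_bool (b \<and> even i), z + of_bool (b \<and> odd i), y + of_bool b * thr p i)"

text \<open>The sides are twice those of \<open>starts\<close>, which leaves room for
  \<open>T\<close> steps.\<close>

definition nodes :: "nat \<Rightarrow> nat \<Rightarrow> node set" where
  "nodes p T = {..T} \<times> {..<2 * T} \<times> {..<2 * T} \<times> {..<2 * (T * 2 ^ p)}"

definition steps :: "nat \<Rightarrow> nat \<Rightarrow> node rel" where
  "steps p T = {(u, move p b u) | u b. u \<in> nodes p T \<and> move p b u \<in> nodes p T}"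

lemma stepsI: "u \<in> nodes p T \<Longrightarrow> move p b u \<in> nodes p T \<Longrightarrow> (u, move p b u) \<in> steps p T"
  unfolding steps_def by blast

lemma stepsE:
  assumes "(u, v) \<in> steps p T"
  obtains b where "v = move p b u" "u \<in> nodes p T" "v \<in> nodes p T"
  using assms unfolding steps_def by blast

definition starts :: "nat \<Rightarrow> nat \<Rightarrow> (nat \<times> nat \<times> nat) set" where
  "starts p T = {..<T} \<times> {..<T} \<times> {..<T * 2 ^ p}"

definition dirs :: "nat \<Rightarrow> (nat \<times> nat) set" where
  "dirs p = {..<2 ^ p} \<times> {..<2 ^ p}"

definition takes :: "nat \<Rightarrow> nat \<times> nat \<Rightarrow> nat \<Rightarrow> bool" where
  "takes p c i \<longleftrightarrow> thr p i < (if even i then fst c else snd c)"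

text \<open>With the parities kept apart, each displacement depends on one coordinate of the
  direction only.\<close>

definition ramp :: "nat \<Rightarrow> bool \<Rightarrow> nat \<Rightarrow> nat \<Rightarrow> nat" where
  "ramp p par c i = (\<Sum>j<i. of_bool (even j = par \<and> thr p j < c))"

definition height :: "nat \<Rightarrow> nat \<times> nat \<Rightarrow> nat \<Rightarrow> nat" where
  "height p c i = (\<Sum>j<i. of_bool (takes p c j) * thr p j)"

fun crit :: "nat \<Rightarrow> (nat \<times> nat \<times> nat) \<times> nat \<times> nat \<Rightarrow> nat \<Rightarrow> node" where
  "crit p ((x, z, y), c) i =
    (i, x + ramp p True (fst c) i, z + ramp p False (snd c) i, y + height p c i)"

lemma thr_less: "thr p i < 2 ^ p"
  by (simp add: thr_def bit_rev_less)

lemma fst_crit [simp]: "fst (crit p d i) = i"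
  by (cases d rule: prod.exhaust; cases "fst d") auto

lemma crit_Suc: "crit p (s, c) (Suc i) = move p (takes p c i) (crit p (s, c) i)"
  by (cases s) (auto simp: ramp_def height_def takes_def)

lemma ramp_le: "ramp p par c i \<le> i"
proof -
  have "ramp p par c i \<le> (\<Sum>j<i. 1)"
    unfolding ramp_def by (intro sum_mono) auto
  then show ?thesis
    by simp
qed

lemma height_le: "height p c i \<le> i * 2 ^ p"
proof -
  have "height p c i \<le> (\<Sum>j<i. 2 ^ p)"
    unfolding height_def using thr_less[THEN less_imp_le] by (intro sum_mono) auto
  then show ?thesis
    by simp
qed

lemma crit_in_nodes:
  assumes "s \<in> starts p T" "i \<le> T"
  shows "crit p (s, c) i \<in> nodes p T"
proof -
  obtain x z y where s: "s = (x, z, y)"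
    by (cases s)
  have "height p c i \<le> T * 2 ^ p"
    using height_le[of p c i] mult_right_mono[OF assms(2), of "2 ^ p"] by linarith
  moreover have "ramp p True (fst c) i \<le> T" "ramp p False (snd c) i \<le> T"
    using ramp_le[of p _ _ i] assms(2) order_trans by blast+
  ultimately show ?thesis
    using assms by (auto simp: s starts_def nodes_def)
qed

lemma crit_path:
  assumes "s \<in> starts p T" "i \<le> T"
  shows "(crit p (s, c) 0, crit p (s, c) i) \<in> (steps p T)\<^sup>*"
  using assms(2)
proof (induction i)
  case (Suc i)
  have "(crit p (s, c) i, crit p (s, c) (Suc i)) \<in> steps p T"
    using crit_in_nodes[OF assms(1), of i c] crit_in_nodes[OF assms(1), of "Suc i" c] Suc.prems
    unfolding crit_Suc by (intro stepsI) simp_all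
  with Suc show ?case
    by (simp add: rtrancl_into_rtrancl)
qed simp

lemma steps_fst: "(u, v) \<in> steps p T \<Longrightarrow> fst v = Suc (fst u)"
  by (cases u) (auto elim: stepsE)

lemma steps_rtrancl_fst: "(u, v) \<in> (steps p T)\<^sup>* \<Longrightarrow> fst u \<le> fst v"
  by (induction rule: rtrancl_induct) (auto dest: steps_fst)

lemma finite_nodes: "finite (nodes p T)"
  by (simp add: nodes_def)

lemma card_nodes: "card (nodes p T) = 8 * (T + 1) * T ^ 3 * 2 ^ p"
  by (simp add: nodes_def card_cartesian_product power3_eq_cube algebra_simps)

lemma card_steps: "card (steps p T) \<le> 2 * card (nodes p T)"
proof -
  have "steps p T \<subseteq> (\<lambda>(u, b). (u, move p b u)) ` (nodes p T \<times> UNIV)"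
    by (auto elim!: stepsE intro!: image_eqI simp del: move.simps)
  then have "card (steps p T) \<le> card (nodes p T \<times> (UNIV :: bool set))"
    using finite_nodes by (intro surj_card_le) auto
  then show ?thesis
    by (simp add: card_cartesian_product)
qed

text \<open>The deficit of a node is the best possible score minus its actual score under the linear
  functional \<open>(2 * fst c - 1, 2 * snd c - 1, - 2)\<close>. By parity no nonzero step scores zero, so
  the critical path in direction \<open>c\<close> is the only path along which the deficit stays
  constant.\<close>

definition gain :: "nat \<Rightarrow> nat \<times> nat \<Rightarrow> nat \<Rightarrow> int" where
  "gain p c i = 2 * int (if even i then fst c else snd c) - 1 - 2 * int (thr p i)"

fun deficit :: "nat \<Rightarrow> nat \<times> nat \<Rightarrow> node \<Rightarrow> int" where
  "deficit p c (i, x, z, y) = (\<Sum>j<i. max 0 (gain p c j))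
    - ((2 * int (fst c) - 1) * int x + (2 * int (snd c) - 1) * int z - 2 * int y)"

lemma deficit_move:
  "deficit p c (move p b u) =
    deficit p c u + max 0 (gain p c (fst u)) - of_bool b * gain p c (fst u)"
  by (cases u) (auto simp: gain_def algebra_simps)

lemma takes_iff_gain: "takes p c i \<longleftrightarrow> gain p c i > 0"
  by (auto simp: takes_def gain_def)

lemma gain_nonzero: "gain p c i \<noteq> 0"
  unfolding gain_def by presburger

lemma deficit_mono: "(u, v) \<in> (steps p T)\<^sup>* \<Longrightarrow> deficit p c u \<le> deficit p c v"
proof (induction rule: rtrancl_induct)
  case (step v w)
  obtain b where "w = move p b v"
    using step.hyps(2) by (rule stepsE)
  then have "deficit p c v \<le> deficit p c w"
    by (cases b) (simp_all add: deficit_move)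
  with step.IH show ?case
    by simp
qed simp

lemma deficit_crit: "deficit p c (crit p (s, c) i) = deficit p c (crit p (s, c) 0)"
proof (induction i)
  case (Suc i)
  then show ?case
    by (simp add: crit_Suc deficit_move takes_iff_gain of_bool_def max_def
        del: deficit.simps crit.simps move.simps)
qed simp

lemma deficit_min_eq_crit:
  assumes "(crit p (s, c) 0, u) \<in> (steps p T)\<^sup>*"
    and "deficit p c u \<le> deficit p c (crit p (s, c) 0)"
  shows "u = crit p (s, c) (fst u)"
  using assms
proof (induction rule: rtrancl_induct)
  case (step u v)
  obtain b where b: "v = move p b u"
    using step.hyps(2) by (rule stepsE)
  have "deficit p c u \<le> deficit p c v"
    using deficit_mono step.hyps(2) by blast
  then have u: "u = crit p (s, c) (fst u)"
    using step.IH step.prems by simp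
  have "deficit p c v \<le> deficit p c u"
    using step.prems deficit_mono[OF step.hyps(1)] by (rule order_trans)
  then have "max 0 (gain p c (fst u)) \<le> of_bool b * gain p c (fst u)"
    by (simp add: b deficit_move)
  then have "b = takes p c (fst u)"
    using gain_nonzero[of p c "fst u"] by (cases b) (auto simp: takes_iff_gain)
  then have "v = crit p (s, c) (Suc (fst u))"
    using b by (simp only: crit_Suc flip: u)
  then show ?case
    by (simp only: fst_crit)
qed (cases s, simp)

text \<open>The deficit never decreases along a path and agrees at both ends, so it cannot rise in
  between.\<close>

lemma on_crit:
  assumes "(crit p (s, c) 0, u) \<in> (steps p T)\<^sup>*" "(u, crit p (s, c) T) \<in> (steps p T)\<^sup>*"
  shows "u = crit p (s, c) (fst u)"
  using deficit_mono[OF assms(2), of c] deficit_min_eq_crit[OF assms(1)] deficit_crit[of p c s T]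
  by simp

section \<open>Few critical paths share a long subpath\<close>

lemma ramp_add:
  "ramp p par c (l + t) = ramp p par c l + (\<Sum>j\<in>{l..<l + t}. of_bool (even j = par \<and> thr p j < c))"
  unfolding ramp_def
  by (subst lessThan_atLeast0, subst sum.atLeastLessThan_concat[symmetric, of 0 l])
    (auto simp: lessThan_atLeast0)

text \<open>A whole block of length \<open>2 ^ (p - j)\<close> fits between \<open>c\<close> and
  \<open>c'\<close>. Some layer of the window has its threshold there, and only \<open>c'\<close>
  takes its step; on all other layers \<open>c'\<close> takes at least the steps of
  \<open>c\<close>.\<close>

lemma ramp_window_less:
  assumes "j \<le> p" "2 ^ Suc j \<le> t" "c + 2 * 2 ^ (p - j) \<le> c'" "c' < 2 ^ p"
  shows "(\<Sum>i\<in>{l..<l + t}. of_bool (even i = par \<and> thr p i < c)) <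
         (\<Sum>i\<in>{l..<l + t}. of_bool (even i = par \<and> thr p i < c') :: nat)"
proof -
  define w :: nat where "w = 2 ^ (p - j)"
  define b where "b = Suc (c div w)"
  have w: "w > 0" and p: "2 ^ p = 2 ^ j * w"
    using assms(1) by (simp_all add: w_def flip: power_add)
  have c: "c = c div w * w + c mod w" "c mod w < w" "c + 2 * w \<le> c'"
    using w assms(3) unfolding w_def by (simp_all only: div_mult_mod_eq mod_less_divisor)
  have bounds: "c < b * w" "b * w + w \<le> c'"
    using c unfolding b_def mult_Suc by linarith+
  then have "b * w < 2 ^ j * w"
    using assms(4) w p by linarith
  then have "b < 2 ^ j"
    by simp
  then obtain i where i: "l \<le> i" "i < l + 2 ^ Suc j" "even i = par" "thr p i div w = b"
    using bit_rev_window[OF assms(1)] unfolding thr_def w_def by blast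
  have "thr p i = b * w + thr p i mod w"
    using i(4) by (metis div_mult_mod_eq)
  moreover have "thr p i mod w < w"
    using w by simp
  ultimately have "c < thr p i" "thr p i < c'"
    using bounds by linarith+
  then show ?thesis
    using i(1-3) assms(2,3) by (intro sum_strict_mono_ex1) (auto intro!: bexI[of _ i])
qed

text \<open>Members of the fibre differ by less than \<open>2 * 2 ^ (p - j)\<close>, so all lie in
  one short interval from the least one on.\<close>

lemma card_ramp_fibre:
  assumes "j \<le> p" "2 ^ Suc j \<le> t"
  shows "card {c. c < 2 ^ p \<and> ramp p par c (l + t) = ramp p par c l + a} \<le> 2 * 2 ^ (p - j)"
    (is "card ?A \<le> _")
proof (cases "?A = {}")
  case False
  have fin: "finite ?A"
    by (rule finite_subset[of _ "{..<2 ^ p}"]) auto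
  then have min: "Min ?A \<in> ?A"
    using False by (rule Min_in)
  have "?A \<subseteq> {Min ?A..<Min ?A + 2 * 2 ^ (p - j)}"
  proof
    fix c assume c: "c \<in> ?A"
    have "\<not> Min ?A + 2 * 2 ^ (p - j) \<le> c"
      using ramp_window_less[OF assms, of "Min ?A" c par l] c min by (auto simp: ramp_add)
    with c fin show "c \<in> {Min ?A..<Min ?A + 2 * 2 ^ (p - j)}"
      by simp
  qed
  then have "card ?A \<le> card {Min ?A..<Min ?A + 2 * 2 ^ (p - j)}"
    by (intro card_mono) auto
  then show ?thesis
    by simp
next
  case True
  then show ?thesis
    by (simp only: card.empty zero_le)
qed

lemma card_shared_le:
  assumes "j \<le> p" "2 ^ Suc j \<le> fst v - fst u"
  shows "card {d \<in> starts p T \<times> dirs p. u = crit p d (fst u) \<and> v = crit p d (fst v)}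
    \<le> 4 * 4 ^ (p - j)" (is "card ?Q \<le> _")
proof -
  obtain l x z y where u: "u = (l, x, z, y)"
    by (cases u)
  obtain l' x' z' y' where v: "v = (l', x', z', y')"
    by (cases v)
  define t where "t = l' - l"
  have t: "2 ^ Suc j \<le> t"
    using assms(2) by (simp add: u v t_def)
  then have "0 < t"
    using less_le_trans by fastforce
  then have l': "l' = l + t"
    by (simp add: t_def)
  let ?A = "\<lambda>par a. {c. c < 2 ^ p \<and> ramp p par c (l + t) = ramp p par c l + a}"
  have fin: "finite (?A par a)" for par a
    by (rule finite_subset[of _ "{..<2 ^ p}"]) auto
  \<comment> \<open>Given \<open>u\<close>, the direction determines the start. So only directions
    are counted, and the two displacements restrict their coordinates independently.\<close>
  have "inj_on snd ?Q"
    by (auto simp: inj_on_def u)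
  moreover have "snd ` ?Q \<subseteq> ?A True (x' - x) \<times> ?A False (z' - z)"
    by (auto simp: u v l' dirs_def ramp_add)
  ultimately have "card ?Q \<le> card (?A True (x' - x) \<times> ?A False (z' - z))"
    using fin by (intro card_inj_on_le) auto
  also have "\<dots> \<le> (2 * 2 ^ (p - j)) * (2 * 2 ^ (p - j))"
    unfolding card_cartesian_product by (intro mult_mono card_ramp_fibre assms(1) t) auto
  also have "\<dots> = 4 * 4 ^ (p - j)"
    by (simp add: power_mult_distrib[symmetric])
  finally show ?thesis .
qed

section \<open>The lower bound\<close>

text \<open>Numbers below \<open>n\<close> that encode no node become isolated vertices, so the
  vertex count is exactly \<open>n\<close>.\<close>

lemma ex_nat_digraph_copy:
  assumes "finite V" "E \<subseteq> V \<times> V" "irrefl E" "card V \<le> n"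
  obtains G :: "nat pair_pre_digraph" and enc dec where
    "pair_digraph G" "pverts G = {..<n}" "parcs G = map_prod enc enc ` E"
    "\<And>v. v \<in> V \<Longrightarrow> dec (enc v) = v" "\<And>v. v \<in> V \<Longrightarrow> enc v < n"
proof -
  obtain enc where enc: "bij_betw enc V {0..<card V}"
    using ex_bij_betw_finite_nat[OF assms(1)] by blast
  then have less: "enc v < n" if "v \<in> V" for v
    using bij_betwE[OF enc] that assms(4) by fastforce
  let ?G = "\<lparr>pverts = {..<n}, parcs = map_prod enc enc ` E\<rparr>"
  have "finite E"
    using assms(1,2) by (meson finite_SigmaI finite_subset)
  moreover have "enc x \<noteq> enc y" if "(x, y) \<in> E" for x y
    using that assms(2,3) enc by (auto simp: bij_betw_def irrefl_def inj_on_eq_iff)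
  ultimately have "pair_digraph ?G"
    using assms(2) less by unfold_locales auto
  moreover have "inv_into V enc (enc v) = v" if "v \<in> V" for v
    using that enc by (simp add: bij_betw_def)
  ultimately show thesis
    using that[of ?G enc "inv_into V enc"] less by simp
qed

text \<open>The depth is \<open>T = 4 ^ p / 2 ^ (k + 9)\<close>: by \<open>card_shared_le\<close>, a shortcut across \<open>t\<close> layers
  saves \<open>O(4 ^ p / t)\<close> hops in total if \<open>t < 2 ^ Suc p\<close> and \<open>O(T)\<close> hops otherwise, and both are
  \<open>O(4 ^ p / 2 ^ k)\<close> once \<open>t\<close> is at least the threshold \<open>2 ^ (k + 13)\<close>.\<close>

lemma shared_weight_le:
  fixes e k :: nat
  defines "p \<equiv> e + k + 12" and "T \<equiv> 2 ^ (2 * e + 15 + k)"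
  assumes "2 ^ (13 + k) \<le> fst v - fst u" "fst v \<le> T"
  shows "(fst v - fst u) *
    card {d \<in> starts p T \<times> dirs p. u = crit p d (fst u) \<and> v = crit p d (fst v)} \<le> 4 * T"
    (is "?t * card ?Q \<le> _")
proof (cases "2 ^ Suc p \<le> ?t")
  case True
  then have "card ?Q \<le> 4"
    using card_shared_le[of p p v u T] by simp
  moreover have "?t \<le> T"
    using assms(4) by simp
  ultimately show ?thesis
    using mult_mono[of ?t T "card ?Q" 4] by (simp add: mult.commute)
next
  case False
  have "1 \<le> ?t"
    using assms(3) by (meson le_trans one_le_numeral one_le_power)
  then obtain i where i: "2 ^ i \<le> ?t" "?t < 2 ^ (i + 1)"
    using ex_power_ivl1[OF order_refl] by blast
  have "2 ^ (13 + k) < (2 :: nat) ^ (i + 1)" "2 ^ i < (2 :: nat) ^ Suc p"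
    using i False assms(3) by linarith+
  then have "0 < i" "i < Suc p"
    by (simp_all only: power_strict_increasing_iff[of "2::nat"] one_less_numeral_iff semiring_norm)
  then obtain j where j: "i = Suc j" "j \<le> p"
    by (cases i) auto
  \<comment> \<open>Replacing the factor \<open>2 ^ (13 + k)\<close> by \<open>?t\<close> gives
    \<open>?t * ?t * card ?Q\<close>, which is bounded by a multiple of \<open>4 ^ p\<close>
    whatever \<open>j\<close> is.\<close>
  have "?t * card ?Q * 2 ^ (13 + k) \<le> ?t * card ?Q * ?t"
    using assms(3) by (intro mult_left_mono) auto
  also have "\<dots> = (?t * ?t) * card ?Q"
    by simp
  also have "\<dots> \<le> (2 ^ (j + 2) * 2 ^ (j + 2)) * (4 * 4 ^ (p - j))"
    using i j card_shared_le[of j p v u T] by (intro mult_mono) auto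
  also have "\<dots> = 64 * (4 ^ j * 4 ^ (p - j))"
    by (simp add: power_mult_distrib[symmetric] power_add)
  also have "\<dots> = 64 * 4 ^ p"
    using j(2) by (simp flip: power_add)
  also have "\<dots> = 2 ^ (6 + 2 * p)"
    by (simp add: power_add power_mult)
  also have "6 + 2 * p = 2 + (2 * e + 15 + k) + (13 + k)"
    by (simp add: p_def)
  also have "2 ^ \<dots> = 4 * T * 2 ^ (13 + k)"
    unfolding T_def power_add[of _ _ "13 + k"] power_add[of _ 2] by simp
  finally show ?thesis
    by simp
qed

text \<open>If the diameter were small, short arcs would cover at most half of each critical path.
  The other halves, \<open>R\<close> layers each, exceed what \<open>card H\<close> shortcuts can
  serve at \<open>4 * T\<close> each.\<close>

lemma ex_shortcut_resistant_digraph: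
  fixes e k n :: nat
  assumes n: "2 ^ (9 * (e + k + 12)) \<le> n"
  obtains G :: "nat pair_pre_digraph" where "pair_digraph G" "pverts G = {..<n}"
    "\<And>H. shortcut_set G H \<Longrightarrow> card H \<le> 2 ^ k * card (parcs G) \<Longrightarrow>
      2 ^ (2 * e + 1) < shortcut_diameter G H"
proof -
  define p where "p = e + k + 12"
  define T :: nat where "T = 2 ^ (2 * e + 15 + k)"
  define R :: nat where "R = 2 ^ (2 * e + 14 + k)"
  let ?E = "steps p T" and ?V = "nodes p T" and ?I = "starts p T \<times> dirs p"
  have T: "T = 2 * R" and R: "0 < R"
    by (simp_all add: T_def R_def power_add)
  then have "T > 0"
    by simp
  have "T + 1 \<le> 2 * T"
    using T R by simp
  then have card_V: "card ?V \<le> 16 * T ^ 4 * 2 ^ p"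
    using mult_right_mono[of "T + 1" "2 * T" "8 * T ^ 3 * 2 ^ p"]
    by (simp add: card_nodes power_eq_if algebra_simps)
  also have "\<dots> = 2 ^ (4 + 4 * (2 * e + 15 + k) + p)"
  proof -
    have "T ^ 4 = 2 ^ (4 * (2 * e + 15 + k))" "16 = (2 :: nat) ^ 4"
      unfolding T_def by (simp_all only: power_mult[symmetric] mult.commute) simp
    then show ?thesis
      by (simp only: power_add)
  qed
  \<comment> \<open>Without \<open>p\<close> the exponent is \<open>8 * e + 4 * k + 64\<close>,
    which is at most \<open>8 * p\<close>.\<close>
  also have "\<dots> \<le> 2 ^ (9 * p)"
    by (intro power_increasing) (auto simp: p_def)
  finally have "card ?V \<le> n"
    using n by (simp add: p_def)
  moreover have "?E \<subseteq> ?V \<times> ?V" "irrefl ?E"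
    by (auto simp: irrefl_def simp del: move.simps elim: stepsE dest: steps_fst)
  ultimately obtain G :: "nat pair_pre_digraph" and enc dec where
    G: "pair_digraph G" "pverts G = {..<n}" "parcs G = map_prod enc enc ` ?E"
    and dec: "\<And>v. v \<in> ?V \<Longrightarrow> dec (enc v) = v" and enc: "\<And>v. v \<in> ?V \<Longrightarrow> enc v < n"
    using ex_nat_digraph_copy[OF finite_nodes] by metis
  interpret pair_digraph G by fact
  have dec_arc: "(dec a, dec b) \<in> ?E" if "(a, b) \<in> parcs G" for a b
    using that dec \<open>?E \<subseteq> ?V \<times> ?V\<close> by (auto simp: G(3))
  \<comment> \<open>\<open>dec\<close> is arbitrary on the padding vertices, but these have no arcs
    and reach only themselves.\<close>
  have dec_reach: "(dec a, dec b) \<in> ?E\<^sup>*" if "a \<rightarrow>\<^sup>*\<^bsub>with_proj G\<^esub> b" for a b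
    using reachable_rtranclI[OF that]
    by (induction rule: rtrancl_induct) (auto intro: rtrancl_into_rtrancl dec_arc)
  have enc_reach: "enc u \<rightarrow>\<^sup>*\<^bsub>with_proj G\<^esub> enc v" if "(u, v) \<in> ?E\<^sup>*" "u \<in> ?V" for u v
    using that
  proof (induction rule: rtrancl_induct)
    case (step v w)
    have "(enc v, enc w) \<in> parcs G"
      using step.hyps(2) by (auto simp: G(3))
    with step show ?case
      using reachable_adj_trans by blast
  qed (simp add: G(2) enc)
  show thesis
  proof (rule that[OF G(1,2)], rule ccontr)
    fix H
    assume H: "shortcut_set G H" and card_H: "card H \<le> 2 ^ k * card (parcs G)"
      and "\<not> 2 ^ (2 * e + 1) < shortcut_diameter G H"
    then have diam: "shortcut_diameter G H \<le> 2 ^ (2 * e + 1)"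
      by simp
    let ?src = "\<lambda>d. enc (crit p d 0)" and ?dst = "\<lambda>d. enc (crit p d T)"
    have ends: "dec (?src d) = crit p d 0" "dec (?dst d) = crit p d T"
      "crit p d 0 \<in> ?V" if "d \<in> ?I" for d
      using that dec crit_in_nodes by (cases d; auto)+
    have cong: "(fst (dec v) - fst (dec u)) *
        card {d \<in> ?I. ?src d \<rightarrow>\<^sup>*\<^bsub>with_proj G\<^esub> u \<and> u \<rightarrow>\<^sup>*\<^bsub>with_proj G\<^esub> v \<and> v \<rightarrow>\<^sup>*\<^bsub>with_proj G\<^esub> ?dst d}
        \<le> 4 * T" (is "_ * card ?P \<le> _") if long: "2 ^ (13 + k) \<le> fst (dec v) - fst (dec u)" for u v
    \<comment> \<open>Here \<open>u\<close> and \<open>v\<close> are any numbers; only a demand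
      routed through them bounds the layer of \<open>v\<close>.\<close>
    proof (cases "?P = {}")
      case False
      let ?Q = "{d \<in> ?I. dec u = crit p d (fst (dec u)) \<and> dec v = crit p d (fst (dec v))}"
      have on: "dec u = crit p d (fst (dec u)) \<and> dec v = crit p d (fst (dec v)) \<and> fst (dec v) \<le> T"
        if "d \<in> ?P" for d
      proof -
        obtain s c where d: "d = (s, c)"
          by (cases d)
        have "(crit p d 0, dec u) \<in> ?E\<^sup>*" "(dec u, dec v) \<in> ?E\<^sup>*" "(dec v, crit p d T) \<in> ?E\<^sup>*"
          using that dec_reach[of "?src d" u] dec_reach[of u v] dec_reach[of v "?dst d"] ends[of d]
          by auto
        then show ?thesis
          using on_crit[of p s c "dec u" T] on_crit[of p s c "dec v" T]
            steps_rtrancl_fst[of "dec v" "crit p d T"]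
          unfolding d by (metis fst_crit rtrancl_trans)
      qed
      with False have "fst (dec v) \<le> T"
        by blast
      then have "(fst (dec v) - fst (dec u)) * card ?Q \<le> 4 * T"
        using shared_weight_le[of k "dec v" "dec u" e] long unfolding p_def T_def by blast
      moreover have "finite ?I"
        by (simp add: starts_def dirs_def)
      then have "card ?P \<le> card ?Q"
        using on by (intro card_mono) auto
      ultimately show ?thesis
        by (meson le_trans mult_le_mono2)
    next
      case True
      then show ?thesis
        by (simp only: card.empty mult_0_right zero_le)
    qed
    have "card ?I * (T - 2 ^ (2 * e + 1) * 2 ^ (13 + k)) \<le> card H * (4 * T)"
    proof (rule congestion_bound[OF pair_fin_digraph_axioms H diam,
          where src = ?src and dst = ?dst and f = "\<lambda>a. fst (dec a)"])
      show "finite ?I"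
        by (simp add: starts_def dirs_def)
      show "?src d \<rightarrow>\<^sup>*\<^bsub>with_proj G\<^esub> ?dst d" if "d \<in> ?I" for d
        using that ends(3) by (intro enc_reach) (auto intro: crit_path simp del: crit.simps)
      show "T \<le> fst (dec (?dst d)) - fst (dec (?src d))" if "d \<in> ?I" for d
        using ends[OF that] by simp
      show "fst (dec v) - fst (dec u) < 2 ^ (13 + k)" if "(u, v) \<in> parcs G" for u v
        using steps_fst[OF dec_arc[OF that]] power_strict_increasing[of 1 "13 + k" "2 :: nat"]
        by simp
    qed (rule cong)
    moreover have "T - 2 ^ (2 * e + 1) * 2 ^ (13 + k) = R"
      by (simp add: T_def R_def power_add)
    moreover have "card ?I = T ^ 3 * 2 ^ p * 4 ^ p"
      by (simp add: starts_def dirs_def card_cartesian_product power3_eq_cube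
          power_mult_distrib[symmetric])
    moreover have "card H \<le> 2 ^ k * (2 * (16 * T ^ 4 * 2 ^ p))"
    proof -
      have "finite ?E"
        using \<open>?E \<subseteq> ?V \<times> ?V\<close> finite_nodes by (meson finite_SigmaI finite_subset)
      then have "card (parcs G) \<le> card ?E"
        unfolding G(3) by (rule card_image_le)
      also have "\<dots> \<le> 2 * (16 * T ^ 4 * 2 ^ p)"
        using card_steps[of p T] card_V by linarith
      finally show ?thesis
        using card_H by (meson le_trans mult_le_mono2)
    qed
    ultimately have "T ^ 3 * 2 ^ p * 4 ^ p * R \<le> card H * (4 * T)"
      "card H * (4 * T) \<le> 2 ^ k * (2 * (16 * T ^ 4 * 2 ^ p)) * (4 * T)"
      by (simp_all only: mult_le_mono1)
    then have "T ^ 3 * 2 ^ p * 4 ^ p * R \<le> 2 ^ k * (2 * (16 * T ^ 4 * 2 ^ p)) * (4 * T)"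
      by (rule order_trans)
    also have "\<dots> = T ^ 3 * 2 ^ p * (2 ^ k * 256 * T) * R"
    proof -
      have "T ^ 4 = T ^ 3 * T"
        by (simp add: eval_nat_numeral)
      moreover have "4 * T = 8 * R"
        using T by simp
      ultimately show ?thesis
        by (simp only: mult_ac)
    qed
    finally have "4 ^ p \<le> 2 ^ k * 256 * T"
      using R \<open>T > 0\<close> by simp
    \<comment> \<open>The depth \<open>T\<close> is chosen so that the inequality just derived fails
      by a factor of two.\<close>
    moreover have "4 ^ p = 2 * (2 ^ k * 256 * T)"
    proof -
      have "(4 :: nat) ^ p = 2 ^ (2 * p)"
        by (simp add: power_mult)
      also have "2 * p = 1 + k + 8 + (2 * e + 15 + k)"
        by (simp add: p_def)
      finally have "(4 :: nat) ^ p = 2 ^ (1 + k + 8 + (2 * e + 15 + k))" .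
      then show ?thesis
        unfolding T_def power_add[of _ _ "2 * e + 15 + k"] power_add[of _ _ 8] power_add[of _ 1 k]
        by simp
    qed
    ultimately show False
      using \<open>T > 0\<close> by simp
  qed
qed

theorem theorem8p1:
  shows "\<forall>C::real. C > 0 \<longrightarrow>
    (\<exists>c::real. c > 0 \<and> (\<exists>N::nat. \<forall>n\<ge>N.
      \<exists>G :: nat pair_pre_digraph.
        pair_digraph G \<and> card (pverts G) = n \<and>
        (\<forall>H. shortcut_set G H \<and> real (card H) \<le> C * real (card (parcs G)) \<longrightarrow>
             real (shortcut_diameter G H) \<ge> c * real n powr (2 / 9))))"
proof (intro allI impI)
  fix C :: real
  obtain k where k: "C < 2 ^ k"
    using real_arch_pow[of 2 C] by auto
  \<comment> \<open>With \<open>p = e + k + 12\<close> below, \<open>n < 2 ^ (9 * (p + 1))\<close>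
    bounds \<open>n powr (2 / 9)\<close> by \<open>2 ^ (2 * e + 2 * k + 26)\<close>, which is
    \<open>2 ^ (2 * e + 1) / c\<close>.\<close>
  define c :: real where "c = 1 / 2 ^ (25 + 2 * k)"
  have "\<exists>G :: nat pair_pre_digraph. pair_digraph G \<and> card (pverts G) = n \<and>
        (\<forall>H. shortcut_set G H \<and> real (card H) \<le> C * real (card (parcs G)) \<longrightarrow>
             real (shortcut_diameter G H) \<ge> c * real n powr (2 / 9))"
    if "2 ^ (9 * (k + 12)) \<le> n" for n
  proof -
    have "1 \<le> n"
      using that by (metis le_trans one_le_numeral one_le_power)
    \<comment> \<open>Rounding \<open>n\<close> down to a power of \<open>2 ^ 9\<close> costs only a
      constant factor.\<close>
    then obtain p where p: "512 ^ p \<le> n" "n < 512 ^ (p + 1)"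
      using ex_power_ivl1[of 512 n] by auto
    have pow: "(512 :: nat) ^ q = 2 ^ (9 * q)" for q
      by (simp add: power_mult)
    have "2 ^ (9 * (k + 12)) < (2 :: nat) ^ (9 * (p + 1))"
      using that p(2) unfolding pow by linarith
    then have "k + 12 \<le> p"
      by simp
    then obtain e where e: "p = e + k + 12"
      by (metis add.assoc add.commute le_Suc_ex)
    obtain G :: "nat pair_pre_digraph" where G: "pair_digraph G" "pverts G = {..<n}"
      "\<And>H. shortcut_set G H \<Longrightarrow> card H \<le> 2 ^ k * card (parcs G) \<Longrightarrow>
        2 ^ (2 * e + 1) < shortcut_diameter G H"
      using ex_shortcut_resistant_digraph[of e k n] p(1) unfolding pow e by metis
    have "real n \<le> 2 ^ (9 * (p + 1))"
      using p(2) unfolding pow by (metis less_imp_le of_nat_le_iff of_nat_numeral of_nat_power)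
    then have "real n powr (2 / 9) \<le> (2 ^ (9 * (p + 1))) powr (2 / 9)"
      by (intro powr_mono2) auto
    also have "\<dots> = 2 ^ (2 * (p + 1))"
      by (simp add: powr_powr powr_realpow[symmetric] add_divide_distrib del: power_Suc)
    also have "\<dots> = 2 ^ (2 * e + 1) / c"
      by (simp add: c_def e power_add algebra_simps)
    finally have c: "c * real n powr (2 / 9) \<le> 2 ^ (2 * e + 1)"
      by (simp add: c_def field_simps)
    have "c * real n powr (2 / 9) \<le> real (shortcut_diameter G H)"
      if H: "shortcut_set G H" "real (card H) \<le> C * real (card (parcs G))" for H
    proof -
      have "real (card H) \<le> 2 ^ k * real (card (parcs G))"
        using H(2) k by (meson less_imp_le mult_right_mono of_nat_0_le_iff order_trans)
      then have "card H \<le> 2 ^ k * card (parcs G)"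
        by (metis of_nat_le_iff of_nat_mult of_nat_numeral of_nat_power)
      then have "2 ^ (2 * e + 1) \<le> real (shortcut_diameter G H)"
        using G(3)[OF H(1)] by (metis less_imp_le of_nat_le_iff of_nat_numeral of_nat_power)
      with c show ?thesis
        by linarith
    qed
    with G(1,2) show ?thesis
      by (intro exI[of _ G]) auto
  qed
  moreover have "c > 0"
    by (simp add: c_def)
  ultimately show "\<exists>c>0. \<exists>N::nat. \<forall>n\<ge>N. \<exists>G :: nat pair_pre_digraph.
      pair_digraph G \<and> card (pverts G) = n \<and>
        (\<forall>H. shortcut_set G H \<and> real (card H) \<le> C * real (card (parcs G)) \<longrightarrow>
             real (shortcut_diameter G H) \<ge> c * real n powr (2 / 9))"
    by blast
qed

end
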